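(* Let $m,n,c$ be positive integers such that $mnc\equiv 0$ or $3\pmod 4$, and suppose $m,n\geqslant 7$ are both odd. Then there exists an integer Heffter array set $\mathrm{IHS}(m,n;c)$.
   Context: An integer Heffter array set $\mathrm{IHS}(m,n;c)$ is a collection of $c$ completely filled $m\times n$ arrays with integer entries such that the absolute values of all $mnc$ entries (taken over all $c$ arrays) are exactly $1,2,\ldots,mnc$, each occurring exactly once, and in every array the entries of each row and of each column sum to $0$. *)

theory Defs
  imports Main
begin

text \<open>An integer Heffter array set IHS(m,n;c), represented as a function
  H k i j = entry in row i, column j of the k-th array (k < c, i < m, j < n).\<close>

definition is_IHS :: "nat \<Rightarrow> nat \<Rightarrow> nat \<Rightarrow> (nat \<Rightarrow> nat \<Rightarrow> nat \<Rightarrow> int) \<Rightarrow> bool" where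
  "is_IHS m n c H \<longleftrightarrow>
     bij_betw (\<lambda>(k, i, j). nat \<bar>H k i j\<bar>) ({0..<c} \<times> {0..<m} \<times> {0..<n}) {1..m * n * c}
   \<and> (\<forall>k<c. \<forall>i<m. (\<Sum>j<n. H k i j) = 0)
   \<and> (\<forall>k<c. \<forall>j<n. (\<Sum>i<m. H k i j) = 0)"

definition IHS_exists :: "nat \<Rightarrow> nat \<Rightarrow> nat \<Rightarrow> bool" where
  "IHS_exists m n c \<longleftrightarrow> (\<exists>H. is_IHS m n c H)"

end

theory Submission
  imports Defs
begin

text \<open>Write \<open>m = 3 + 2p\<close> and \<open>n = 3 + 2q\<close> and cut every array into a \<open>3 \<times> 3\<close> corner, a
  \<open>3 \<times> 2q\<close> strip, a \<open>2p \<times> 3\<close> strip and a \<open>2p \<times> 2q\<close> block, each with zero row and column sums.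
  A corner is filled by three progressions \<open>a\<close>, \<open>b\<close>, \<open>a + b + d\<close> of length 3 with common difference
  \<open>d\<close>, placed along a Latin square. A strip is cut into pairs of zero-sum columns
  \<open>(x, y, z)\<close> and \<open>-(x + 1, y + 1, z - 2)\<close>, called gadgets: two gadgets with opposite signs, or
  three with rotated rows, have zero row sums. The block is filled by runs of four consecutive
  numbers. So the \<open>c\<close> corners and the \<open>g = c (p + q)\<close> gadgets have to be packed into an initial
  segment of the positive integers with at most \<open>g\<close> left-over runs of length 4; all larger numbers
  are free for the blocks.

  Four gadgets fit into four runs of length 4 and one of length 8, and \<open>h\<close> such groups fit into
  four runs of length \<open>4h\<close> and one of length \<open>8h\<close>; an odd number \<open>c\<close> of corners fits into three
  runs of length \<open>3c\<close>. These families are arranged above a small explicit packing, which absorbs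
  the residues of \<open>c\<close> modulo 8 and of \<open>g\<close> modulo 4.\<close>

section \<open>Arrays with zero row and column sums\<close>

definition fill :: "nat \<Rightarrow> nat \<Rightarrow> nat set \<Rightarrow> bool" where
  "fill p q S \<longleftrightarrow> (\<exists>f :: nat \<Rightarrow> nat \<Rightarrow> int.
     (\<lambda>(i, j). nat \<bar>f i j\<bar>) ` ({..<p} \<times> {..<q}) = S
     \<and> (\<forall>i<p. (\<Sum>j<q. f i j) = 0) \<and> (\<forall>j<q. (\<Sum>i<p. f i j) = 0))"

lemma fillI:
  assumes "(\<lambda>(i, j). nat \<bar>f i j\<bar>) ` ({..<p} \<times> {..<q}) = S"
    and "\<And>i. i < p \<Longrightarrow> (\<Sum>j<q. f i j :: int) = 0" "\<And>j. j < q \<Longrightarrow> (\<Sum>i<p. f i j) = 0"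
  shows "fill p q S"
  using assms unfolding fill_def by blast

lemma fill_transpose:
  assumes "fill p q S"
  shows "fill q p S"
proof -
  obtain f :: "nat \<Rightarrow> nat \<Rightarrow> int" where f: "(\<lambda>(i, j). nat \<bar>f i j\<bar>) ` ({..<p} \<times> {..<q}) = S"
    "\<forall>i<p. (\<Sum>j<q. f i j) = 0" "\<forall>j<q. (\<Sum>i<p. f i j) = 0"
    using assms unfolding fill_def by blast
  have "(\<lambda>(i, j). nat \<bar>f j i\<bar>) ` ({..<q} \<times> {..<p}) = S"
    unfolding f(1)[symmetric] by auto
  then show ?thesis
    using f(2,3) by (intro fillI[where f = "\<lambda>i j. f j i"]) auto
qed

lemma image_grid_split:
  "g ` ({..<p :: nat} \<times> {..<q + r :: nat}) = g ` ({..<p} \<times> {..<q}) \<union> (\<lambda>(i, j). g (i, q + j)) ` ({..<p} \<times> {..<r})"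
proof -
  have "{..<p} \<times> {..<q + r} = {..<p} \<times> {..<q} \<union> (\<lambda>(i, j). (i, q + j)) ` ({..<p} \<times> {..<r})"
  proof (rule set_eqI)
    fix x :: "nat \<times> nat"
    obtain i j where x: "x = (i, j)" by (cases x)
    show "x \<in> {..<p} \<times> {..<q + r} \<longleftrightarrow> x \<in> {..<p} \<times> {..<q} \<union> (\<lambda>(i, j). (i, q + j)) ` ({..<p} \<times> {..<r})"
      by (cases "j < q") (auto simp: x image_iff intro: bexI[of _ "j - q"])
  qed
  then show ?thesis
    by (simp only: image_Un image_image) (simp add: case_prod_unfold)
qed

lemma sum_lessThan_add: "(\<Sum>j<q + r. g j) = (\<Sum>j<q. g j) + (\<Sum>j<r. g (q + j :: nat) :: int)"
  by (induction r) auto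

lemma fill_join:
  assumes "fill p q S" "fill p r T"
  shows "fill p (q + r) (S \<union> T)"
proof -
  obtain f :: "nat \<Rightarrow> nat \<Rightarrow> int" where f: "(\<lambda>(i, j). nat \<bar>f i j\<bar>) ` ({..<p} \<times> {..<q}) = S"
    "\<forall>i<p. (\<Sum>j<q. f i j) = 0" "\<forall>j<q. (\<Sum>i<p. f i j) = 0"
    using assms(1) unfolding fill_def by blast
  obtain g :: "nat \<Rightarrow> nat \<Rightarrow> int" where g: "(\<lambda>(i, j). nat \<bar>g i j\<bar>) ` ({..<p} \<times> {..<r}) = T"
    "\<forall>i<p. (\<Sum>j<r. g i j) = 0" "\<forall>j<r. (\<Sum>i<p. g i j) = 0"
    using assms(2) unfolding fill_def by blast
  define h where "h i j = (if j < q then f i j else g i (j - q))" for i j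
  show ?thesis
  proof (rule fillI[where f = h])
    show "(\<lambda>(i, j). nat \<bar>h i j\<bar>) ` ({..<p} \<times> {..<q + r}) = S \<union> T"
      unfolding image_grid_split f(1)[symmetric] g(1)[symmetric]
      by (intro arg_cong2[of _ _ _ _ "(\<union>)"] image_cong) (auto simp: h_def)
    show "(\<Sum>j<q + r. h i j) = 0" if "i < p" for i
      using that f(2) g(2) by (simp add: sum_lessThan_add h_def)
    show "(\<Sum>i<p. h i j) = 0" if "j < q + r" for j
      using that f(3) g(3) by (cases "j < q") (auto simp: h_def)
  qed
qed

lemma fill_stack:
  assumes "fill p r S" "fill q r T"
  shows "fill (p + q) r (S \<union> T)"
  using assms by (blast intro: fill_transpose fill_join)

section \<open>Packings\<close>

text \<open>Neither \<open>fill\<close> nor the packings below require disjointness: at the end \<open>m n c\<close> entries have to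
  cover a set of \<open>m n c\<close> numbers, so that no absolute value can be repeated.\<close>

definition corner :: "nat set \<Rightarrow> bool" where
  "corner S \<longleftrightarrow>
     (\<exists>a b d. S = {a, a + d, a + 2 * d, b, b + d, b + 2 * d, a + b + d, a + b + 2 * d, a + b + 3 * d})"

definition gadget :: "nat set \<Rightarrow> bool" where
  "gadget S \<longleftrightarrow>
     (\<exists>x y z :: int. x + y + z = 0 \<and> S = (\<lambda>v. nat \<bar>v\<bar>) ` {x, x + 1, y, y + 1, z, z - 2})"

definition quad :: "nat set \<Rightarrow> bool" where
  "quad S \<longleftrightarrow> (\<exists>a. S = {a..<a + 4})"

inductive packs :: "nat \<Rightarrow> nat \<Rightarrow> nat \<Rightarrow> nat set \<Rightarrow> bool" where
  empty: "packs 0 0 0 {}"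
| corner: "packs c g q S \<Longrightarrow> corner T \<Longrightarrow> packs (Suc c) g q (S \<union> T)"
| gadget: "packs c g q S \<Longrightarrow> gadget T \<Longrightarrow> packs c (Suc g) q (S \<union> T)"
| quad: "packs c g q S \<Longrightarrow> quad T \<Longrightarrow> packs c g (Suc q) (S \<union> T)"

lemma packs_Un:
  assumes "packs c g q S" "packs c' g' q' T"
  shows "packs (c + c') (g + g') (q + q') (S \<union> T)"
  using assms(2) by induction (use assms(1) packs.intros in \<open>simp_all add: Un_assoc[symmetric]\<close>)

text \<open>The order in which pieces were added is immaterial: the last piece goes to the first
  side as long as that side still wants a piece of its kind, and to the second side otherwise. This
  lets one global packing be dealt out to arrays, and within an array to corner, strips and
  block.\<close>

lemma packs_split:
  assumes "packs c g q S" "c = c1 + c2" "g = g1 + g2" "q = q1 + q2"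
  obtains S1 S2 where "packs c1 g1 q1 S1" "packs c2 g2 q2 S2" "S = S1 \<union> S2"
proof -
  have "\<exists>S1 S2. packs c1 g1 q1 S1 \<and> packs c2 g2 q2 S2 \<and> S = S1 \<union> S2"
    using assms
  proof (induction arbitrary: c1 c2 g1 g2 q1 q2 rule: packs.induct)
    case empty
    then show ?case using packs.empty by auto
  next
    case (corner c g q S T)
    show ?case
    proof (cases c1)
      case 0
      then show ?thesis
        using corner.prems corner.hyps corner.IH[of 0 c g1 g2 q1 q2] by (metis Un_assoc add_0 packs.corner)
    next
      case (Suc k)
      then obtain S1 S2 where "packs k g1 q1 S1" "packs c2 g2 q2 S2" "S = S1 \<union> S2"
        using corner.prems corner.IH[of k c2 g1 g2 q1 q2] by auto
      with corner.hyps Suc show ?thesis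
        by (metis Un_assoc Un_commute packs.corner)
    qed
  next
    case (gadget c g q S T)
    show ?case
    proof (cases g1)
      case 0
      then show ?thesis
        using gadget.prems gadget.hyps gadget.IH[of c1 c2 0 g q1 q2] by (metis Un_assoc add_0 packs.gadget)
    next
      case (Suc k)
      then obtain S1 S2 where "packs c1 k q1 S1" "packs c2 g2 q2 S2" "S = S1 \<union> S2"
        using gadget.prems gadget.IH[of c1 c2 k g2 q1 q2] by auto
      with gadget.hyps Suc show ?thesis
        by (metis Un_assoc Un_commute packs.gadget)
    qed
  next
    case (quad c g q S T)
    show ?case
    proof (cases q1)
      case 0
      then show ?thesis
        using quad.prems quad.hyps quad.IH[of c1 c2 g1 g2 0 q] by (metis Un_assoc add_0 packs.quad)
    next
      case (Suc k)
      then obtain S1 S2 where "packs c1 g1 k S1" "packs c2 g2 q2 S2" "S = S1 \<union> S2"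
        using quad.prems quad.IH[of c1 c2 g1 g2 k q2] by auto
      with quad.hyps Suc show ?thesis
        by (metis Un_assoc Un_commute packs.quad)
    qed
  qed
  then show thesis using that by blast
qed

section \<open>Small blocks filled by explicit matrices, written as lists of rows\<close>

lemma fill_matrix:
  assumes "length M = p" "\<forall>r\<in>set M. length r = q \<and> sum_list r = (0 :: int)"
    and "\<forall>j<q. sum_list (map (\<lambda>r. r ! j) M) = 0"
    and "(\<lambda>v. nat \<bar>v\<bar>) ` set (concat M) = S"
  shows "fill p q S"
proof (rule fillI[where f = "\<lambda>i j. M ! i ! j"])
  have M: "set M = (!) M ` {..<p}"
    using assms(1) by (auto simp: set_conv_nth)
  have "(\<lambda>(i, j). nat \<bar>M ! i ! j\<bar>) ` ({..<p} \<times> {..<q}) = (\<lambda>v. nat \<bar>v\<bar>) ` (\<Union>i<p. \<Union>j<q. {M ! i ! j})"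
    by auto
  also have "(\<Union>i<p. \<Union>j<q. {M ! i ! j}) = (\<Union>i<p. set (M ! i))"
    using assms(1,2) by (intro SUP_cong) (auto simp: set_conv_nth)
  also have "\<dots> = set (concat M)"
    using assms(1) by (simp add: M)
  finally show "(\<lambda>(i, j). nat \<bar>M ! i ! j\<bar>) ` ({..<p} \<times> {..<q}) = S"
    using assms(4) by simp
  show "(\<Sum>j<q. M ! i ! j) = 0" if "i < p" for i
    using that assms(1,2) by (auto simp: sum_list_sum_nth atLeast0LessThan)
  show "(\<Sum>i<p. M ! i ! j) = 0" if "j < q" for j
    using that assms(1,3) by (auto simp: sum_list_sum_nth atLeast0LessThan)
qed

text \<open>The constants \<open>up\<close>, \<open>dn\<close> and \<open>opp\<close> keep the simplifier from distributing signs over sums before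
  absolute values are taken.\<close>

definition up :: "nat \<Rightarrow> int" where "up x = int x"
definition dn :: "nat \<Rightarrow> int" where "dn x = - int x"

lemma abs_up_dn [simp]: "nat \<bar>up x\<bar> = x" "nat \<bar>dn x\<bar> = x"
  by (auto simp: up_def dn_def)

lemma corner_fill:
  assumes "corner S" shows "fill 3 3 S"
proof -
  obtain a b d where S:
    "S = {a, a + d, a + 2 * d, b, b + d, b + 2 * d, a + b + d, a + b + 2 * d, a + b + 3 * d}"
    using assms unfolding corner_def by blast
  \<comment> \<open>Number the terms of each progression 0, 1, 2. Then the i-th term from
    \<open>a\<close> plus the j-th term from \<open>b\<close> is the k-th term from
    \<open>a + b + d\<close> whenever i + j = k + 1, and all six lines of the matrix have this
    form.\<close>
  let ?M = "[[up a, up (b + d), dn (a + b + d)],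
             [dn (a + b + 2 * d), up (a + 2 * d), up b],
             [up (b + 2 * d), dn (a + b + 3 * d), up (a + d)]]"
  show ?thesis
  proof (rule fill_matrix[where M = ?M])
    show "\<forall>j<3. sum_list (map (\<lambda>r. r ! j) ?M) = 0"
      by (auto simp: less_Suc_eq numeral_eq_Suc up_def dn_def)
    show "\<forall>r\<in>set ?M. length r = 3 \<and> sum_list r = 0"
      by (simp add: up_def dn_def)
    show "(\<lambda>v. nat \<bar>v\<bar>) ` set (concat ?M) = S"
      unfolding S by (simp; blast)
  qed simp_all
qed

definition opp :: "int \<Rightarrow> int" where "opp v = - v"

lemma abs_opp [simp]: "\<bar>opp v\<bar> = \<bar>v\<bar>"
  by (simp add: opp_def)

lemma gadget_2_fill:
  assumes "gadget S" "gadget T" shows "fill 3 4 (S \<union> T)"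
proof -
  obtain x y z where S: "x + y + z = 0" "S = (\<lambda>v. nat \<bar>v\<bar>) ` {x, x + 1, y, y + 1, z, z - 2}"
    using assms(1) unfolding gadget_def by blast
  obtain u v w where T: "u + v + w = 0" "T = (\<lambda>v. nat \<bar>v\<bar>) ` {u, u + 1, v, v + 1, w, w - 2}"
    using assms(2) unfolding gadget_def by blast
  \<comment> \<open>The two columns of the first gadget have row sums (-1, -1, 2). The second gadget
    enters with opposite sign and cancels them.\<close>
  let ?M = "[[x, opp (x + 1), opp u, u + 1],
             [y, opp (y + 1), opp v, v + 1],
             [z, opp (z - 2), opp w, w - 2]]"
  show ?thesis
  proof (rule fill_matrix[where M = ?M])
    show "\<forall>j<4. sum_list (map (\<lambda>r. r ! j) ?M) = 0"
      using S(1) T(1) by (auto simp: less_Suc_eq numeral_eq_Suc opp_def)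
    show "\<forall>r\<in>set ?M. length r = 4 \<and> sum_list r = 0"
      by (simp add: opp_def)
    show "(\<lambda>v. nat \<bar>v\<bar>) ` set (concat ?M) = S \<union> T"
      unfolding S(2) T(2) by (simp; blast)
  qed simp_all
qed

lemma gadget_3_fill:
  assumes "gadget S" "gadget T" "gadget U" shows "fill 3 6 (S \<union> T \<union> U)"
proof -
  obtain x y z where S: "x + y + z = 0" "S = (\<lambda>v. nat \<bar>v\<bar>) ` {x, x + 1, y, y + 1, z, z - 2}"
    using assms(1) unfolding gadget_def by blast
  obtain u v w where T: "u + v + w = 0" "T = (\<lambda>v. nat \<bar>v\<bar>) ` {u, u + 1, v, v + 1, w, w - 2}"
    using assms(2) unfolding gadget_def by blast
  obtain k l m where U: "k + l + m = 0" "U = (\<lambda>v. nat \<bar>v\<bar>) ` {k, k + 1, l, l + 1, m, m - 2}"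
    using assms(3) unfolding gadget_def by blast
  \<comment> \<open>The row sum 2 is placed in the third, second and first row in turn, so every row
    receives 2 - 1 - 1.\<close>
  let ?M = "[[x, opp (x + 1), u, opp (u + 1), m, opp (m - 2)],
             [y, opp (y + 1), w, opp (w - 2), k, opp (k + 1)],
             [z, opp (z - 2), v, opp (v + 1), l, opp (l + 1)]]"
  show ?thesis
  proof (rule fill_matrix[where M = ?M])
    show "\<forall>j<6. sum_list (map (\<lambda>r. r ! j) ?M) = 0"
      using S(1) T(1) U(1) by (auto simp: less_Suc_eq numeral_eq_Suc opp_def)
    show "\<forall>r\<in>set ?M. length r = 6 \<and> sum_list r = 0"
      by (simp add: opp_def)
    show "(\<lambda>v. nat \<bar>v\<bar>) ` set (concat ?M) = S \<union> T \<union> U"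
      unfolding S(2) T(2) U(2) by (simp; blast)
  qed simp_all
qed

inductive_cases packs_0E: "packs 0 0 0 S"
inductive_cases packs_cornerE: "packs (Suc c) 0 0 S"
inductive_cases packs_gadgetE: "packs 0 (Suc g) 0 S"
inductive_cases packs_quadE: "packs 0 0 (Suc q) S"

lemma atLeastLessThan_4: "{a..<a + 4 :: nat} = {a, a + 1, a + 2, a + 3}"
  by auto

lemma quads_4_4_fill:
  assumes "packs 0 0 4 S" shows "fill 4 4 S"
proof -
  obtain a b c d where S: "S = {a..<a+4} \<union> {b..<b+4} \<union> {c..<c+4} \<union> {d..<d+4}"
    using assms by (auto elim!: packs_quadE packs_0E simp: quad_def numeral_eq_Suc)
  \<comment> \<open>A run of length 4 with alternating signs fills a 2 x 2 block with row sums -1, 1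
    and column sums -2, 2. Reversing all signs in blocks arranged as on a chessboard cancels
    both.\<close>
  let ?M = "[[up a, dn (a + 1), dn b, up (b + 1)],
             [dn (a + 2), up (a + 3), up (b + 2), dn (b + 3)],
             [dn c, up (c + 1), up d, dn (d + 1)],
             [up (c + 2), dn (c + 3), dn (d + 2), up (d + 3)]]"
  show ?thesis
  proof (rule fill_matrix[where M = ?M])
    show "\<forall>j<4. sum_list (map (\<lambda>r. r ! j) ?M) = 0"
      by (auto simp: less_Suc_eq numeral_eq_Suc up_def dn_def)
    show "\<forall>r\<in>set ?M. length r = 4 \<and> sum_list r = 0"
      by (simp add: up_def dn_def)
    show "(\<lambda>v. nat \<bar>v\<bar>) ` set (concat ?M) = S"
      unfolding S atLeastLessThan_4 by (simp; blast)
  qed simp_all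
qed

lemma quads_4_6_fill:
  assumes "packs 0 0 6 S" shows "fill 4 6 S"
proof -
  obtain a b c d e f where S: "S = {a..<a+4} \<union> {b..<b+4} \<union> {c..<c+4} \<union> {d..<d+4} \<union> {e..<e+4} \<union> {f..<f+4}"
    using assms by (auto elim!: packs_quadE packs_0E simp: quad_def numeral_eq_Suc)
  \<comment> \<open>With three blocks side by side, the first pair of columns uses transposed
    blocks: their row sums -2, 2 balance two blocks with row sums 1, -1.\<close>
  let ?M = "[[up a, dn (a + 2), dn b, up (b + 1), dn c, up (c + 1)],
             [dn (a + 1), up (a + 3), up (b + 2), dn (b + 3), up (c + 2), dn (c + 3)],
             [dn d, up (d + 2), up e, dn (e + 1), up f, dn (f + 1)],
             [up (d + 1), dn (d + 3), dn (e + 2), up (e + 3), dn (f + 2), up (f + 3)]]"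
  show ?thesis
  proof (rule fill_matrix[where M = ?M])
    show "\<forall>j<6. sum_list (map (\<lambda>r. r ! j) ?M) = 0"
      by (auto simp: less_Suc_eq numeral_eq_Suc up_def dn_def)
    show "\<forall>r\<in>set ?M. length r = 6 \<and> sum_list r = 0"
      by (simp add: up_def dn_def)
    show "(\<lambda>v. nat \<bar>v\<bar>) ` set (concat ?M) = S"
      unfolding S atLeastLessThan_4 by (simp; blast)
  qed simp_all
qed

text \<open>Nine arbitrary runs of length 4 never fill a \<open>6 \<times> 6\<close> block with balanced signs in every line,
  by a parity argument; one run of length 12 removes the obstruction.\<close>

lemma run_quads_6_6_fill:
  assumes "packs 0 0 6 S" shows "fill 6 6 (S \<union> {x..<x + 12})"
proof -
  obtain a1 a2 a3 a4 a5 a6 where S: "S = {a1..<a1+4} \<union> {a2..<a2+4} \<union> {a3..<a3+4} \<union> {a4..<a4+4} \<union> {a5..<a5+4} \<union> {a6..<a6+4}"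
    using assms by (auto elim!: packs_quadE packs_0E simp: quad_def numeral_eq_Suc)
  have x: "{x..<x + 12} = {x, x + 1, x + 2, x + 3, x + 4, x + 5, x + 6, x + 7, x + 8, x + 9, x + 10, x + 11}"
    by (rule set_eqI) (simp; arith)
  let ?M = "[[up x, dn (x + 8), dn (a4 + 1), up (a4 + 3), dn (x + 5), up (x + 11)],
    [dn a1, up (a5 + 1), dn (a5 + 2), dn (a3 + 2), up (a1 + 3), up a3],
    [up (a1 + 2), dn (a5 + 3), up a5, up (a3 + 3), dn (a1 + 1), dn (a3 + 1)],
    [up (a6 + 1), dn (a6 + 2), dn (a2 + 2), up (x + 6), up (a2 + 1), dn (x + 4)],
    [dn (x + 3), up (x + 9), up (a2 + 3), dn (x + 10), dn a2, up (x + 1)],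
    [dn a6, up (a6 + 3), up (a4 + 2), dn a4, up (x + 2), dn (x + 7)]]"
  show ?thesis
  proof (rule fill_matrix[where M = ?M])
    show "\<forall>j<6. sum_list (map (\<lambda>r. r ! j) ?M) = 0"
      by (auto simp: less_Suc_eq numeral_eq_Suc up_def dn_def)
    show "\<forall>r\<in>set ?M. length r = 6 \<and> sum_list r = 0"
      by (simp add: up_def dn_def)
    show "(\<lambda>v. nat \<bar>v\<bar>) ` set (concat ?M) = S \<union> {x..<x + 12}"
      unfolding S atLeastLessThan_4 x by (simp; blast)
  qed simp_all
qed

lemma packs_quads: "packs 0 0 k {x..<x + 4 * k}"
proof (induction k)
  case 0
  then show ?case using packs.empty by simp
next
  case (Suc k)
  have "packs 0 0 (Suc k) ({x..<x + 4 * k} \<union> {x + 4 * k..<x + 4 * k + 4})"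
    by (rule packs.quad[OF Suc]) (auto simp: quad_def)
  also have "{x..<x + 4 * k} \<union> {x + 4 * k..<x + 4 * k + 4} = {x..<x + 4 * Suc k}"
    by auto
  finally show ?case .
qed

section \<open>Strips, inner blocks and whole arrays of arbitrary size\<close>

lemma strip_fill:
  assumes "packs 0 p 0 S" "2 \<le> p" shows "fill 3 (2 * p) S"
  using assms
proof (induction p arbitrary: S rule: less_induct)
  case (less p)
  \<comment> \<open>Every number from 2 on is a sum of twos and threes, so two gadgets are peeled
    off at a time. The same splitting handles the blocks with four rows below.\<close>
  consider "p = 2" | "p = 3" | "4 \<le> p" using less.prems by linarith
  then show ?case
  proof cases
    case 1
    then obtain T U where "gadget T" "gadget U" "S = U \<union> T"
      using less.prems(1) by (auto elim!: packs_gadgetE packs_0E simp: numeral_eq_Suc)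
    then show ?thesis using gadget_2_fill[of U T] 1 by simp
  next
    case 2
    then obtain T U V where "gadget T" "gadget U" "gadget V" "S = U \<union> T \<union> V"
      using less.prems(1) by (auto elim!: packs_gadgetE packs_0E simp: numeral_eq_Suc)
    then show ?thesis using gadget_3_fill[of U T V] 2 by simp
  next
    case 3
    obtain T U where *: "packs 0 2 0 T" "packs 0 (p - 2) 0 U" "S = T \<union> U"
      using 3 by (auto intro: packs_split[OF less.prems(1), of 0 0 2 "p - 2" 0 0])
    have "fill 3 (2 * 2 + 2 * (p - 2)) (T \<union> U)"
      using * 3 less.IH[of 2 T] less.IH[of "p - 2" U] by (intro fill_join) auto
    moreover have "2 * 2 + 2 * (p - 2) = 2 * p" using 3 by simp
    ultimately show ?thesis using * by simp
  qed
qed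

lemma inner_4_fill:
  assumes "packs 0 0 (2 * q) S" "2 \<le> q" shows "fill 4 (2 * q) S"
  using assms
proof (induction q arbitrary: S rule: less_induct)
  case (less q)
  consider "q = 2" | "q = 3" | "4 \<le> q" using less.prems by linarith
  then show ?case
  proof cases
    case 3
    obtain T U where *: "packs 0 0 (2 * 2) T" "packs 0 0 (2 * (q - 2)) U" "S = T \<union> U"
      using 3 by (auto intro: packs_split[OF less.prems(1), of 0 0 0 0 "2 * 2" "2 * (q - 2)"])
    have "fill 4 (2 * 2 + 2 * (q - 2)) (T \<union> U)"
      using * 3 less.IH[of 2 T] less.IH[of "q - 2" U] by (intro fill_join) auto
    moreover have "2 * 2 + 2 * (q - 2) = 2 * q" using 3 by simp
    ultimately show ?thesis using * by simp
  qed (use less.prems quads_4_4_fill quads_4_6_fill in auto)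
qed

lemma fill_empty: "fill 0 q {}"
  by (rule fillI[where f = "\<lambda>_ _. 0"]) auto

lemma inner_even_fill:
  assumes "packs 0 0 (2 * k * q) S" "2 \<le> q" shows "fill (4 * k) (2 * q) S"
  using assms(1)
proof (induction k arbitrary: S)
  case 0
  then show ?case by (auto elim: packs_0E intro: fill_empty)
next
  case (Suc k)
  have "2 * Suc k * q = 2 * k * q + 2 * q" by simp
  then obtain T U where *: "packs 0 0 (2 * k * q) T" "packs 0 0 (2 * q) U" "S = T \<union> U"
    using packs_split[OF Suc.prems, of 0 0 0 0 "2 * k * q" "2 * q"] by auto
  have "fill (4 * k + 4) (2 * q) (T \<union> U)"
    using * Suc.IH inner_4_fill assms(2) by (intro fill_stack) auto
  then show ?case using * by (simp add: add.commute)
qed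

text \<open>Only a 6 x 6 sub-block resists the 4-row fillings. The rest is a 6 x (2q - 6) piece
  beside it and a (2p - 6) x 2q piece below, each with one dimension divisible by 4. The run of
  length 12 replaces three of the \<open>p * q\<close> quads.\<close>

lemma inner_odd_fill:
  assumes "packs 0 0 (p * q - 3) S" "odd p" "odd q" "3 \<le> p" "3 \<le> q"
  shows "fill (2 * p) (2 * q) (S \<union> {x..<x + 12})"
proof -
  obtain a where a: "p = 2 * a + 3"
    using assms(2,4) by (auto elim!: oddE intro: that[of "(p - 3) div 2"])
  obtain b where b: "q = 2 * b + 3"
    using assms(3,5) by (auto elim!: oddE intro: that[of "(q - 3) div 2"])
  have pq: "p * q - 3 = (6 + 2 * b * 3) + 2 * a * q"
    unfolding a b by (simp add: algebra_simps)
  obtain S1 S2 where S: "packs 0 0 (6 + 2 * b * 3) S1" "packs 0 0 (2 * a * q) S2" "S = S1 \<union> S2"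
    using packs_split[OF assms(1), of 0 0 0 0 "6 + 2 * b * 3" "2 * a * q"] pq by auto
  obtain T U where T: "packs 0 0 6 T" "packs 0 0 (2 * b * 3) U" "S1 = T \<union> U"
    using packs_split[OF S(1), of 0 0 0 0 6 "2 * b * 3"] by auto
  have "fill 6 (6 + 4 * b) ((T \<union> {x..<x + 12}) \<union> U)"
    using run_quads_6_6_fill[OF T(1)] fill_transpose[OF inner_even_fill[OF T(2)]]
    by (intro fill_join) auto
  moreover have "6 + 4 * b = 2 * q" by (simp add: b)
  ultimately have "fill (6 + 4 * a) (2 * q) (((T \<union> {x..<x + 12}) \<union> U) \<union> S2)"
    using assms(5) inner_even_fill[OF S(2)] by (intro fill_stack) auto
  moreover have "6 + 4 * a = 2 * p" "((T \<union> {x..<x + 12}) \<union> U) \<union> S2 = S \<union> {x..<x + 12}"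
    using S T by (auto simp: a)
  ultimately show ?thesis by simp
qed

text \<open>\<open>R\<close> holds the numbers which the inner block takes besides its quads: a run
  of length 12 if \<open>p\<close> and \<open>q\<close> are odd, nothing otherwise.\<close>

lemma array_fill:
  assumes "packs 1 (p + q) r S" "2 \<le> p" "2 \<le> q"
    and inner: "\<And>T. packs 0 0 r T \<Longrightarrow> fill (2 * p) (2 * q) (T \<union> R)"
  shows "fill (3 + 2 * p) (3 + 2 * q) (S \<union> R)"
proof -
  obtain A D where AD: "packs 1 (p + q) 0 A" "packs 0 0 r D" "S = A \<union> D"
    using packs_split[OF assms(1), of 1 0 "p + q" 0 0 r] by auto
  obtain A1 C where A: "packs 1 q 0 A1" "packs 0 p 0 C" "A = A1 \<union> C"
    using packs_split[OF AD(1), of 1 0 q p 0 0] by auto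
  obtain K B where A1: "packs 1 0 0 K" "packs 0 q 0 B" "A1 = K \<union> B"
    using packs_split[OF A(1), of 1 0 0 q 0 0] by auto
  have "corner K"
    using A1(1) by (auto elim!: packs_cornerE packs_0E)
  then have top: "fill 3 (3 + 2 * q) (K \<union> B)"
    using strip_fill[OF A1(2)] assms(3) by (intro fill_join corner_fill) auto
  have "fill (2 * p) (3 + 2 * q) (C \<union> (D \<union> R))"
    using strip_fill[OF A(2)] assms(2) inner[OF AD(2)] by (intro fill_join) (auto intro: fill_transpose)
  with top have "fill (3 + 2 * p) (3 + 2 * q) ((K \<union> B) \<union> (C \<union> (D \<union> R)))"
    by (intro fill_stack) auto
  then show ?thesis
    unfolding AD(3) A(3) A1(3) by (simp add: Un_assoc)
qed

section \<open>From one packing to the c arrays\<close>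

lemma packs_family:
  assumes "packs c (c * g) (c * r) S"
  shows "\<exists>F. (\<forall>k<c. packs 1 g r (F k)) \<and> S = (\<Union>k<c. F k)"
  using assms
proof (induction c arbitrary: S)
  case 0
  then show ?case by (auto elim: packs_0E)
next
  case (Suc c)
  obtain T U where *: "packs c (c * g) (c * r) T" "packs 1 g r U" "S = T \<union> U"
    using packs_split[OF Suc.prems, of c 1 "c * g" g "c * r" r] by auto
  obtain F where F: "\<forall>k<c. packs 1 g r (F k)" "T = (\<Union>k<c. F k)"
    using Suc.IH[OF *(1)] by blast
  show ?case
  proof (intro exI[of _ "F(c := U)"] conjI)
    show "S = (\<Union>k<Suc c. (F(c := U)) k)"
      using F * by (auto simp: lessThan_Suc)
  qed (use F * in \<open>auto simp: less_Suc_eq\<close>)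
qed

lemma IHS_exists_fill:
  assumes "\<forall>k<c. fill m n (F k)" "(\<Union>k<c. F k) = {1..m * n * c}"
  shows "IHS_exists m n c"
proof -
  obtain H :: "nat \<Rightarrow> nat \<Rightarrow> nat \<Rightarrow> int" where
    H: "\<forall>k<c. (\<lambda>(i, j). nat \<bar>H k i j\<bar>) ` ({..<m} \<times> {..<n}) = F k \<and>
      (\<forall>i<m. (\<Sum>j<n. H k i j) = 0) \<and> (\<forall>j<n. (\<Sum>i<m. H k i j) = 0)"
    using assms(1) unfolding fill_def by metis
  let ?h = "\<lambda>(k, i, j). nat \<bar>H k i j\<bar>" and ?I = "{0..<c} \<times> {0..<m} \<times> {0..<n}"
  have "?h ` ?I = (\<Union>k<c. (\<lambda>(i, j). nat \<bar>H k i j\<bar>) ` ({..<m} \<times> {..<n}))"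
    by (force simp: image_iff)
  also have "\<dots> = {1..m * n * c}"
    using H assms(2) by auto
  finally have img: "?h ` ?I = {1..m * n * c}" .
  then have "inj_on ?h ?I"
    by (intro eq_card_imp_inj_on) (simp_all add: mult.commute)
  with img have "bij_betw ?h ?I {1..m * n * c}"
    by (simp add: bij_betw_def)
  with H show ?thesis
    unfolding IHS_exists_def is_IHS_def by blast
qed

text \<open>The packing supplies all corners and gadgets. Its left-over quads go into the inner
  blocks, which are completed by larger numbers; \<open>u\<close> is the number of quads per block
  that give way to a run of length 12, and these runs form the top of the whole range.\<close>

lemma IHS_exists_packs:
  fixes p q c r :: nat
  assumes "2 \<le> p" "2 \<le> q" "r \<le> c * (p + q)"
    and packs: "packs c (c * (p + q)) r {1..9 * c + 6 * (c * (p + q)) + 4 * r}"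
  shows "IHS_exists (3 + 2 * p) (3 + 2 * q) c"
proof -
  define odds where "odds \<longleftrightarrow> odd p \<and> odd q"
  define u where "u = (if odds then 3 else 0 :: nat)"
  define N where "N = 9 * c + 6 * (c * (p + q)) + 4 * (c * (p * q - u))"
  \<comment> \<open>This is why at most as many left-over quads as gadgets are allowed: they all fit
    into the blocks. Equality occurs for p = q = 2 and for p = q = 3.\<close>
  have "p + q \<le> p * q - u"
  proof (cases odds)
    case True
    then have "3 \<le> p" "3 \<le> q" using assms(1,2) unfolding odds_def by presburger+
    then obtain a b where "p = 3 + a" "q = 3 + b" using le_Suc_ex by blast
    then show ?thesis using True by (simp add: u_def algebra_simps)
  next
    case False
    from assms(1,2) obtain a b where "p = 2 + a" "q = 2 + b" using le_Suc_ex by blast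
    then show ?thesis using False by (simp add: u_def algebra_simps)
  qed
  then have "r \<le> c * (p * q - u)"
    using assms(3) mult_le_mono2 order_trans by blast
  then obtain s where s: "c * (p * q - u) = r + s" using le_Suc_ex by blast
  let ?E = "9 * c + 6 * (c * (p + q)) + 4 * r"
  \<comment> \<open>The \<open>s\<close> quads still missing are cut from the numbers just above the
    packing.\<close>
  have "packs (c + 0) (c * (p + q) + 0) (r + s) ({1..?E} \<union> {?E + 1..<?E + 1 + 4 * s})"
    by (intro packs_Un packs packs_quads)
  moreover have "{1..?E} \<union> {?E + 1..<?E + 1 + 4 * s} = {1..N}"
    unfolding N_def s by auto
  ultimately have "packs c (c * (p + q)) (c * (p * q - u)) {1..N}"
    unfolding s by simp
  then obtain F where F: "\<forall>k<c. packs 1 (p + q) (p * q - u) (F k)" "{1..N} = (\<Union>k<c. F k)"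
    using packs_family by blast
  \<comment> \<open>The length \<open>4 * u\<close> is 12 or 0, so \<open>R k\<close> is empty
    unless both parameters are odd.\<close>
  define R where "R k = {N + 1 + 4 * u * k..<N + 1 + 4 * u * k + 4 * u}" for k
  have "fill (3 + 2 * p) (3 + 2 * q) (F k \<union> R k)" if k: "k < c" for k
  proof (rule array_fill[where r = "p * q - u"])
    fix T assume T: "packs 0 0 (p * q - u) T"
    consider "odds" | "\<not> odds" "even p" | "\<not> odds" "even q" using odds_def by blast
    then show "fill (2 * p) (2 * q) (T \<union> R k)"
    proof cases
      case 1
      then have "3 \<le> p" "3 \<le> q" using assms(1,2) unfolding odds_def by presburger+
      with 1 show ?thesis
        using inner_odd_fill[of p q T "N + 1 + 12 * k"] T by (auto simp: odds_def u_def R_def)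
    next
      case 2
      then obtain a where "p = 2 * a" by (auto elim: evenE)
      with 2 show ?thesis
        using inner_even_fill[of a q T] T assms(2) by (auto simp: u_def R_def)
    next
      case 3
      then obtain a where "q = 2 * a" by (auto elim: evenE)
      with 3 show ?thesis
        using fill_transpose[OF inner_even_fill[of a p T]] T assms(1) by (auto simp: u_def R_def mult.commute mult.left_commute)
    qed
  qed (use F k assms(1,2) in auto)
  moreover have "(\<Union>k<c. F k \<union> R k) = {1..(3 + 2 * p) * (3 + 2 * q) * c}"
  proof -
    have R: "(\<Union>k<c'. R k) = {N + 1..<N + 1 + 4 * u * c'}" for c'
      by (induction c') (auto simp: R_def lessThan_Suc algebra_simps)
    have "u \<le> p * q"
    proof (cases "u = 0")
      case False
      then have "3 \<le> p" using assms(1) unfolding u_def odds_def by (cases "p = 2") auto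
      then show ?thesis using assms(2) mult_le_mono[of 3 p 1 q] by (auto simp: u_def)
    qed simp
    then obtain t where t: "p * q = u + t" using le_Suc_ex by blast
    have "N + 4 * u * c = 9 * c + 6 * (c * (p + q)) + 4 * c * (p * q)"
      unfolding N_def t by (simp add: algebra_simps)
    also have "\<dots> = (3 + 2 * p) * (3 + 2 * q) * c"
      by (simp add: algebra_simps)
    finally have "{1..N} \<union> {N + 1..<N + 1 + 4 * u * c} = {1..(3 + 2 * p) * (3 + 2 * q) * c}"
      by auto
    then show ?thesis unfolding UN_Un_distrib F(2)[symmetric] R .
  qed
  ultimately show ?thesis by (intro IHS_exists_fill[where F = "\<lambda>k. F k \<union> R k"]) auto
qed

section \<open>Families of gadgets and corners\<close>

text \<open>In a gadget one pair of entries is at distance 2 and the others at distance 1. Here the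
  wide pair consists of the sums; in \<open>gadget_dn\<close> it is one of the summands. The two
  shapes can therefore interlock on one run.\<close>

definition gadget_up :: "nat \<Rightarrow> nat \<Rightarrow> nat list" where
  "gadget_up a b = [a, a + 1, b, b + 1, a + b, a + b + 2]"

definition gadget_dn :: "nat \<Rightarrow> nat \<Rightarrow> nat list" where
  "gadget_dn a b = [a, a + 2, b, b + 1, a + b + 1, a + b + 2]"

definition corner_list :: "nat \<Rightarrow> nat \<Rightarrow> nat \<Rightarrow> nat list" where
  "corner_list a b d = [a, a + d, a + 2 * d, b, b + d, b + 2 * d, a + b + d, a + b + 2 * d, a + b + 3 * d]"

lemma corner_corner_list: "corner (set (corner_list a b d))"
  unfolding corner_def corner_list_def by (intro exI[of _ a] exI[of _ b] exI[of _ d]) simp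

lemma corner_runs: "corner ({a..<a + 3} \<union> {b..<b + 3} \<union> {a + b + 1..<a + b + 4})"
proof -
  have run: "{x..<x + 3} = {x, x + 1, x + 2}" for x :: nat by auto
  have "{a + b + 1..<a + b + 4} = {a + b + 1, a + b + 2, a + b + 3}" by auto
  then have "{a..<a + 3} \<union> {b..<b + 3} \<union> {a + b + 1..<a + b + 4} = set (corner_list a b 1)"
    unfolding run corner_list_def by (simp only: mult_1_right) auto
  then show ?thesis using corner_corner_list[of a b 1] by (simp only:)
qed

lemma gadget_gadget_up: "gadget (set (gadget_up a b))"
proof -
  have "nat \<bar>int a + 1\<bar> = a + 1" "nat \<bar>int b + 1\<bar> = b + 1" "nat \<bar>- int (a + b)\<bar> = a + b"
    "nat \<bar>- int (a + b) - 2\<bar> = a + b + 2"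
    by auto
  then have "set (gadget_up a b) =
      (\<lambda>v. nat \<bar>v\<bar>) ` {int a, int a + 1, int b, int b + 1, - int (a + b), - int (a + b) - 2}"
    unfolding gadget_up_def by (simp only: image_insert image_empty) simp
  moreover have "int a + int b + - int (a + b) = 0" by simp
  ultimately show ?thesis unfolding gadget_def by blast
qed

lemma gadget_gadget_dn: "gadget (set (gadget_dn a b))"
proof -
  have "nat \<bar>- int (b + 1)\<bar> = b + 1" "nat \<bar>- int (b + 1) + 1\<bar> = b" "nat \<bar>int (a + b + 1)\<bar> = a + b + 1"
    "nat \<bar>int (a + b + 1) + 1\<bar> = a + b + 2" "nat \<bar>- int a\<bar> = a" "nat \<bar>- int a - 2\<bar> = a + 2"
    by auto
  then have "(\<lambda>v. nat \<bar>v\<bar>) ` {- int (b + 1), - int (b + 1) + 1, int (a + b + 1), int (a + b + 1) + 1, - int a, - int a - 2}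
      = {b + 1, b, a + b + 1, a + b + 2, a, a + 2}"
    by (simp only: image_insert image_empty)
  also have "\<dots> = set (gadget_dn a b)"
    unfolding gadget_dn_def by auto
  finally have "set (gadget_dn a b) =
    (\<lambda>v. nat \<bar>v\<bar>) ` {- int (b + 1), - int (b + 1) + 1, int (a + b + 1), int (a + b + 1) + 1, - int a, - int a - 2}" ..
  moreover have "- int (b + 1) + int (a + b + 1) + - int a = 0" by simp
  ultimately show ?thesis unfolding gadget_def by blast
qed

text \<open>The wide pairs of the two upward gadgets occupy every second number of the run at
  \<open>s\<close>, and those of the two downward gadgets occupy the others. The parameter
  \<open>e\<close> decides which of them start at \<open>s\<close> itself.\<close>

lemma four_gadgets:
  assumes "s + e = a + p" "k + e = b + s + 4" "e \<le> 1"
  shows "packs 0 4 0 ({a..<a + 4} \<union> {p..<p + 4} \<union> {b..<b + 4} \<union> {s..<s + 8} \<union> {k..<k + 4})"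
proof -
  have "packs 0 4 0 ((((({} \<union> set (gadget_up a p)) \<union> set (gadget_up (a + 2) (p + 2)))
      \<union> set (gadget_dn (s + 1 - e) (b + 2))) \<union> set (gadget_dn (s + 5 - e) b)))"
    using packs.gadget[OF packs.gadget[OF packs.gadget[OF packs.gadget[OF packs.empty]]]]
      gadget_gadget_up gadget_gadget_dn by (simp add: numeral_eq_Suc)
  also have "(((({} \<union> set (gadget_up a p)) \<union> set (gadget_up (a + 2) (p + 2)))
      \<union> set (gadget_dn (s + 1 - e) (b + 2))) \<union> set (gadget_dn (s + 5 - e) b))
    = {a..<a + 4} \<union> {p..<p + 4} \<union> {b..<b + 4} \<union> {s..<s + 8} \<union> {k..<k + 4}"
  proof -
    have g1: "set (gadget_up a p) = {a, a + 1, p, p + 1, s + e, s + e + 2}"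
      unfolding gadget_up_def assms(1) by simp
    have "a + 2 + 1 = a + 3" "p + 2 + 1 = p + 3" "a + 2 + (p + 2) = s + e + 4" "a + 2 + (p + 2) + 2 = s + e + 6"
      using assms(1) by auto
    then have g2: "set (gadget_up (a + 2) (p + 2)) = {a + 2, a + 3, p + 2, p + 3, s + e + 4, s + e + 6}"
      unfolding gadget_up_def by (simp only: list.set)
    have "s + 1 - e + (b + 2) + 1 = k" "s + 1 - e + 2 = s + 3 - e" "s + 1 - e + (b + 2) + 2 = k + 1" "b + 2 + 1 = b + 3"
      using assms(2,3) by auto
    then have g3: "set (gadget_dn (s + 1 - e) (b + 2)) = {s + 1 - e, s + 3 - e, b + 2, b + 3, k, k + 1}"
      unfolding gadget_dn_def by (simp only: list.set)
    have "s + 5 - e + b + 1 = k + 2" "s + 5 - e + 2 = s + 7 - e" "s + 5 - e + b + 2 = k + 3"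
      using assms(2,3) by auto
    then have g4: "set (gadget_dn (s + 5 - e) b) = {s + 5 - e, s + 7 - e, b, b + 1, k + 2, k + 3}"
      unfolding gadget_dn_def by (simp only: list.set)
    have s8: "{s..<s + 8} = {s, s + 1, s + 2, s + 3, s + 4, s + 5, s + 6, s + 7}"
      by (rule set_eqI) (simp; arith)
    have s: "{s + e, s + e + 2} \<union> {s + e + 4, s + e + 6} \<union> {s + 1 - e, s + 3 - e} \<union> {s + 5 - e, s + 7 - e}
        = {s..<s + 8}"
      using assms(3) unfolding s8 by (cases "e = 0") auto
    show ?thesis
      unfolding g1 g2 g3 g4 s[symmetric] atLeastLessThan_4
      by (simp only: Un_insert_left Un_insert_right Un_empty_left Un_empty_right insert_commute)
  qed
  finally show ?thesis .
qed

text \<open>From group to group, \<open>a\<close>, \<open>p\<close> and \<open>k\<close> advance by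
  4 and \<open>s\<close> by 8, while the run at \<open>b\<close> is used downwards. This keeps both
  equations of \<open>four_gadgets\<close> valid; for the second, the step of \<open>k\<close> is 8
  - 4.\<close>

lemma gadget_family:
  assumes "s + e = a + p" "k + e = b + 4 * h + s" "e \<le> 1"
  shows "packs 0 (4 * h) 0 ({a..<a + 4 * h} \<union> {p..<p + 4 * h} \<union> {b..<b + 4 * h}
    \<union> {s..<s + 8 * h} \<union> {k..<k + 4 * h})"
  using assms
proof (induction h arbitrary: a p s k)
  case 0
  then show ?case using packs.empty by simp
next
  case (Suc h)
  have "packs (0 + 0) (4 * h + 4) (0 + 0)
    (({a + 4..<a + 4 + 4 * h} \<union> {p + 4..<p + 4 + 4 * h} \<union> {b..<b + 4 * h}
      \<union> {s + 8..<s + 8 + 8 * h} \<union> {k + 4..<k + 4 + 4 * h}) \<union>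
     ({a..<a + 4} \<union> {p..<p + 4} \<union> {b + 4 * h..<b + 4 * h + 4} \<union> {s..<s + 8} \<union> {k..<k + 4}))"
    (is "packs _ _ _ ?U")
    using Suc.prems by (intro packs_Un Suc.IH four_gadgets) auto
  also have "?U = {a..<a + 4 * Suc h} \<union> {p..<p + 4 * Suc h} \<union> {b..<b + 4 * Suc h}
    \<union> {s..<s + 8 * Suc h} \<union> {k..<k + 4 * Suc h}"
    by (rule set_eqI) (simp; arith)
  finally show ?case by (simp add: add.commute)
qed

lemma packs_corners:
  assumes "\<And>t. t < n \<Longrightarrow> corner (F t)"
  shows "packs n 0 0 (\<Union>t<n. F t)"
  using assms
proof (induction n)
  case 0
  then show ?case using packs.empty by simp
next
  case (Suc n)
  then have "packs (Suc n) 0 0 ((\<Union>t<n. F t) \<union> F n)"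
    by (intro packs.corner) auto
  then show ?case by (simp add: lessThan_Suc Un_commute)
qed

text \<open>With runs of three indexed 0 to 2k, index i from \<open>a\<close> must be matched with j
  from \<open>b\<close> so that i + j takes each value from k to 3k once. \<open>F\<close> matches i
  = 2t with j = k - t, and \<open>G\<close> matches i = 2t + 1 with j = 2k - t. The number of
  corners has to be odd for the sums to be consecutive.\<close>

lemma corner_family:
  "packs (2 * k + 1) 0 0 ({a..<a + 6 * k + 3} \<union> {b..<b + 6 * k + 3}
     \<union> {a + b + 3 * k + 1..<a + b + 9 * k + 4})"
proof -
  define F where "F t = {a + 6 * t..<a + 6 * t + 3} \<union> {b + 3 * (k - t)..<b + 3 * (k - t) + 3}
    \<union> {a + b + 3 * k + 1 + 3 * t..<a + b + 3 * k + 4 + 3 * t}" for t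
  define G where "G t = {a + 6 * t + 3..<a + 6 * t + 6} \<union> {b + 3 * (2 * k - t)..<b + 3 * (2 * k - t) + 3}
    \<union> {a + b + 6 * k + 4 + 3 * t..<a + b + 6 * k + 7 + 3 * t}" for t
  have "corner (F t)" if t: "t < Suc k" for t
  proof -
    obtain j where j: "k = t + j" using t le_Suc_ex by (auto simp: less_Suc_eq_le)
    show ?thesis
      using corner_runs[of "a + 6 * t" "b + 3 * j"] by (simp add: F_def j algebra_simps)
  qed
  moreover have "corner (G t)" if t: "t < k" for t
  proof -
    obtain j where j: "k = t + j" using t le_Suc_ex less_imp_le by blast
    show ?thesis
      using corner_runs[of "a + 6 * t + 3" "b + 3 * (t + 2 * j)"] by (simp add: G_def j algebra_simps)
  qed
  ultimately have "packs (Suc k + k) (0 + 0) (0 + 0) ((\<Union>t<Suc k. F t) \<union> (\<Union>t<k. G t))"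
    by (intro packs_Un packs_corners)
  also have "(\<Union>t<Suc k. F t) \<union> (\<Union>t<k. G t) = {a..<a + 6 * k + 3} \<union> {b..<b + 6 * k + 3}
     \<union> {a + b + 3 * k + 1..<a + b + 9 * k + 4}" (is "?L = ?A \<union> ?B \<union> ?C")
  proof
    show "?L \<subseteq> ?A \<union> ?B \<union> ?C"
      by (auto simp: F_def G_def)
    have "x \<in> ?L" if x: "x \<in> ?A" for x
    proof -
      define t where "t = (x - a) div 6"
      have "x - a = 6 * t + (x - a) mod 6" "(x - a) mod 6 < 6" "a \<le> x" "x < a + 6 * k + 3"
        using x by (auto simp: t_def)
      then have "(x \<in> F t \<and> t < Suc k) \<or> (x \<in> G t \<and> t < k)"
        unfolding F_def G_def by (cases "(x - a) mod 6 < 3") auto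
      then show ?thesis by blast
    qed
    moreover have "x \<in> ?L" if x: "x \<in> ?B" for x
    proof -
      define t where "t = (x - b) div 3"
      have t: "x - b = 3 * t + (x - b) mod 3" "(x - b) mod 3 < 3" "b \<le> x" "x < b + 6 * k + 3"
        using x by (auto simp: t_def)
      then have "(x \<in> F (k - t) \<and> t < Suc k) \<or> (x \<in> G (2 * k - t) \<and> k < t \<and> t \<le> 2 * k)"
        unfolding F_def G_def by (cases "t \<le> k") auto
      then show ?thesis by fastforce
    qed
    moreover have "x \<in> ?L" if x: "x \<in> ?C" for x
    proof -
      define t where "t = (x - (a + b + 3 * k + 1)) div 3"
      have t: "x - (a + b + 3 * k + 1) = 3 * t + (x - (a + b + 3 * k + 1)) mod 3"
        "(x - (a + b + 3 * k + 1)) mod 3 < 3" "a + b + 3 * k + 1 \<le> x" "x < a + b + 9 * k + 4"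
        using x by (auto simp: t_def)
      then have "(x \<in> F t \<and> t < Suc k) \<or> (x \<in> G (t - Suc k) \<and> k < t \<and> t \<le> 2 * k)"
        unfolding F_def G_def by (cases "t \<le> k") auto
      then show ?thesis by fastforce
    qed
    ultimately show "?A \<union> ?B \<union> ?C \<subseteq> ?L" by blast
  qed
  finally show ?thesis by (simp add: mult_2)
qed

section \<open>Layout of the families above a base packing\<close>

lemma ivl_join: "x \<le> y \<Longrightarrow> y \<le> z \<Longrightarrow> {x..<y} \<union> {y..<z} = {x..<z :: nat}"
  by auto

text \<open>\<open>w\<close> is the first number above the base, and \<open>b\<close>, the larger of
  \<open>w\<close> and \<open>4 * h + e\<close>, is where the family starts. Below this threshold
  the forced positions of its last two runs would overlap the earlier ones; the residue
  \<open>e\<close> makes all gaps multiples of 4.\<close>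

lemma family_start:
  fixes w h e :: nat
  assumes "w mod 4 = e" "e \<le> 1"
  obtains b z y where "b = w + 4 * z" "b = 4 * h + e + 4 * y" "z = 0 \<or> y = 0"
proof -
  define v where "v = w div 4"
  have w: "w = 4 * v + e"
    unfolding v_def assms(1)[symmetric] by simp
  show thesis
  proof (cases "h \<le> v")
    case True
    then obtain y where "v = h + y" using le_Suc_ex by blast
    then show thesis using that[of w 0 y] w by simp
  next
    case False
    then obtain z where "h = v + z" using le_Suc_ex nat_le_linear by blast
    then show thesis using that[of "4 * h + e" z 0] w by simp
  qed
qed

text \<open>The left side counts left-over quads: in the base, below \<open>b\<close>, and in the
  gaps of the family. If \<open>z = 0\<close>, eliminating \<open>y\<close> yields exactly half of
  the last hypothesis. If \<open>y = 0\<close>, already \<open>r + z\<close> is at most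
  \<open>h\<close>.\<close>

lemma gap_bound:
  fixes b c e g h r y z :: nat
  assumes "b = 9 * c + 6 * g + 4 * r + 1 + 4 * z" "b = 4 * h + e + 4 * y" "z = 0 \<or> y = 0" "e \<le> 1"
    and "2 + 18 * c + 8 * g + 12 * r \<le> 20 * h + 2 * e"
  shows "r + z + (h + y) + y \<le> g + 4 * h"
  using assms(3)
proof
  assume z: "z = 0"
  then have "9 * c + 6 * g + 4 * r + 1 = 4 * h + e + 4 * y" using assms(1,2) by simp
  then show ?thesis using z assms(5) by linarith
next
  assume y: "y = 0"
  then have "9 * c + 6 * g + 4 * r + 1 + 4 * z = 4 * h + e" using assms(1,2) by simp
  then show ?thesis using y assms(4) by linarith
qed

text \<open>From below: base, \<open>z1\<close> quads, the runs at \<open>b\<close>,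
  \<open>a\<close>, \<open>p\<close>, then \<open>h + z3\<close> quads, the run at \<open>s\<close>,
  \<open>z3\<close> quads, the run at \<open>k\<close>. The equation
  \<open>b = 4 * h + e + 4 * z3\<close> puts \<open>s\<close> and \<open>k\<close> where
  \<open>gadget_family\<close> demands them.\<close>

lemma layout_without_corners:
  assumes base: "packs c g r {1..9 * c + 6 * g + 4 * r}"
    and e: "(9 * c + 6 * g + 4 * r + 1) mod 4 = e" "e \<le> 1"
    and h: "2 + 18 * c + 8 * g + 12 * r \<le> 20 * h + 2 * e"
  shows "\<exists>q \<le> g + 4 * h. packs c (g + 4 * h) q {1..9 * c + 6 * (g + 4 * h) + 4 * q}"
proof -
  define w where "w = 9 * c + 6 * g + 4 * r + 1"
  obtain b z1 z3 where b: "b = w + 4 * z1" "b = 4 * h + e + 4 * z3" "z1 = 0 \<or> z3 = 0"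
    using family_start[of w e h] e unfolding w_def by blast
  define a p p' s s' k k' where "a = b + 4 * h" and "p = a + 4 * h" and "p' = p + 4 * h"
    and "s = p' + 4 * (h + z3)" and "s' = s + 8 * h" and "k = s' + 4 * z3" and "k' = k + 4 * h"
  note defs = a_def p_def p'_def s_def s'_def k_def k'_def
  have fam: "packs 0 (4 * h) 0 ({a..<p} \<union> {p..<p'} \<union> {b..<a} \<union> {s..<s'} \<union> {k..<k'})"
  proof -
    have "s + e = a + p" "k + e = b + 4 * h + s"
      using b(2) unfolding defs by simp_all
    then show ?thesis
      using gadget_family[of s e a p k b h] e(2)
      unfolding a_def[symmetric] p_def[symmetric] p'_def[symmetric] s'_def[symmetric] k'_def[symmetric] by blast
  qed
  define q where "q = r + z1 + (h + z3) + z3"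
  have "packs (c + 0 + (0 + (0 + 0))) (g + 4 * h + (0 + (0 + 0))) (r + 0 + (z1 + ((h + z3) + z3)))
    ({1..9 * c + 6 * g + 4 * r} \<union> ({a..<p} \<union> {p..<p'} \<union> {b..<a} \<union> {s..<s'} \<union> {k..<k'}) \<union>
     ({w..<w + 4 * z1} \<union> ({p'..<p' + 4 * (h + z3)} \<union> {s'..<s' + 4 * z3})))"
    by (intro packs_Un base fam packs_quads)
  moreover have "{1..9 * c + 6 * g + 4 * r} = {1..<w}"
    unfolding w_def by auto
  ultimately have "packs c (g + 4 * h) q
    ({1..<w} \<union> ({a..<p} \<union> {p..<p'} \<union> {b..<a} \<union> {s..<s'} \<union> {k..<k'}) \<union>
     ({w..<b} \<union> ({p'..<s} \<union> {s'..<k})))"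
    unfolding b(1)[symmetric] s_def[symmetric] k_def[symmetric] q_def by (simp only: add_0_right add.assoc)
  also have "{1..<w} \<union> ({a..<p} \<union> {p..<p'} \<union> {b..<a} \<union> {s..<s'} \<union> {k..<k'}) \<union>
     ({w..<b} \<union> ({p'..<s} \<union> {s'..<k}))
    = {1..<w} \<union> {w..<b} \<union> {b..<a} \<union> {a..<p} \<union> {p..<p'} \<union> {p'..<s} \<union> {s..<s'} \<union> {s'..<k} \<union> {k..<k'}"
    by (simp only: Un_ac)
  also have "\<dots> = {1..<k'}"
  proof -
    have "1 \<le> w" "1 \<le> b" "1 \<le> a" "1 \<le> p" "1 \<le> p'" "1 \<le> s" "1 \<le> s'" "1 \<le> k"
      "w \<le> b" "b \<le> a" "a \<le> p" "p \<le> p'" "p' \<le> s" "s \<le> s'" "s' \<le> k" "k \<le> k'"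
      unfolding defs b(1) w_def by simp_all
    then show ?thesis by (simp only: ivl_join)
  qed
  also have "{1..<k'} = {1..9 * c + 6 * (g + 4 * h) + 4 * q}"
  proof -
    have "k' = 9 * c + 6 * (g + 4 * h) + 4 * q + 1"
      using b(1) unfolding defs q_def w_def by simp
    then show ?thesis by auto
  qed
  finally have "packs c (g + 4 * h) q {1..9 * c + 6 * (g + 4 * h) + 4 * q}" .
  moreover have "q \<le> g + 4 * h"
    unfolding q_def by (rule gap_bound[OF b(1)[unfolded w_def] b(2,3) e(2) h])
  ultimately show ?thesis by (intro exI[of _ q] conjI)
qed

text \<open>The corner runs at \<open>A\<close> and \<open>B\<close> are inserted before
  \<open>a\<close> and \<open>p\<close>, and their sums at \<open>C\<close> split the gap below
  \<open>s\<close>. The two parts have \<open>z2\<close> and \<open>z3\<close> quads with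
  \<open>z2 + z3 = h + z4\<close>, so the number of left-over quads is the same as without
  corners.\<close>

lemma layout_with_corners:
  assumes base: "packs c g r {1..9 * c + 6 * g + 4 * r}"
    and e: "(9 * c + 6 * g + 4 * r + 1) mod 4 = e" "e \<le> 1" "(3 * m + 2) mod 4 = e" "3 * m + 2 \<le> 4 * h"
    and h: "2 + 18 * c + 8 * g + 12 * r \<le> 20 * h + 2 * e"
  shows "\<exists>q \<le> g + 4 * h. packs (c + (2 * m + 1)) (g + 4 * h) q
    {1..9 * (c + (2 * m + 1)) + 6 * (g + 4 * h) + 4 * q}"
proof -
  define w where "w = 9 * c + 6 * g + 4 * r + 1"
  obtain b z1 z4 where b: "b = w + 4 * z1" "b = 4 * h + e + 4 * z4" "z1 = 0 \<or> z4 = 0"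
    using family_start[of w e h] e(1,2) unfolding w_def by blast
  obtain z3 where z3: "3 * m + 2 = e + 4 * z3"
    using e(3) mult_div_mod_eq[of 4 "3 * m + 2"] by (metis add.commute)
  \<comment> \<open>Here \<open>3 * m + 2 \<le> 4 * h\<close> is needed: it keeps the run of corner
    sums above the run at \<open>p\<close>.\<close>
  obtain z2 where z2: "b = 3 * m + 2 + 4 * z2"
  proof -
    have "z3 \<le> h + z4" using z3 e(4) by linarith
    then obtain z where "h + z4 = z3 + z" using le_Suc_ex by blast
    then have "b = 3 * m + 2 + 4 * z" using b(2) z3 by linarith
    then show thesis by (rule that)
  qed
  define A a B p p' C C' s s' k k' where "A = b + 4 * h" and "a = A + 6 * m + 3" and "B = a + 4 * h"
    and "p = B + 6 * m + 3" and "p' = p + 4 * h" and "C = p' + 4 * z2" and "C' = C + 6 * m + 3"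
    and "s = C' + 4 * z3" and "s' = s + 8 * h" and "k = s' + 4 * z4" and "k' = k + 4 * h"
  note defs = A_def a_def B_def p_def p'_def C_def C'_def s_def s'_def k_def k'_def
  have fam: "packs 0 (4 * h) 0 ({a..<B} \<union> {p..<p'} \<union> {b..<A} \<union> {s..<s'} \<union> {k..<k'})"
  proof -
    have "s + e = a + p" "k + e = b + 4 * h + s"
      using z2 z3 b(2) unfolding defs by simp_all
    then show ?thesis
      using gadget_family[of s e a p k b h] e(2)
      unfolding A_def[symmetric] B_def[symmetric] p'_def[symmetric] s'_def[symmetric] k'_def[symmetric] by blast
  qed
  have cor: "packs (2 * m + 1) 0 0 ({A..<a} \<union> {B..<p} \<union> {C..<C'})"
  proof -
    have "A + B + 3 * m + 1 = C" "A + B + 9 * m + 4 = C'"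
      using z2 unfolding defs by simp_all
    then show ?thesis
      using corner_family[of m A B] unfolding a_def[symmetric] p_def[symmetric] by simp
  qed
  define q where "q = r + z1 + z2 + z3 + z4"
  have "packs (c + 0 + (2 * m + 1) + (0 + (0 + (0 + 0)))) (g + 4 * h + 0 + (0 + (0 + (0 + 0)))) (r + 0 + 0 + (z1 + (z2 + (z3 + z4))))
    ({1..9 * c + 6 * g + 4 * r} \<union> ({a..<B} \<union> {p..<p'} \<union> {b..<A} \<union> {s..<s'} \<union> {k..<k'}) \<union>
     ({A..<a} \<union> {B..<p} \<union> {C..<C'}) \<union>
     ({w..<w + 4 * z1} \<union> ({p'..<p' + 4 * z2} \<union> ({C'..<C' + 4 * z3} \<union> {s'..<s' + 4 * z4}))))"
    by (intro packs_Un base fam cor packs_quads)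
  moreover have "{1..9 * c + 6 * g + 4 * r} = {1..<w}"
    unfolding w_def by auto
  ultimately have "packs (c + (2 * m + 1)) (g + 4 * h) q
    ({1..<w} \<union> ({a..<B} \<union> {p..<p'} \<union> {b..<A} \<union> {s..<s'} \<union> {k..<k'}) \<union>
     ({A..<a} \<union> {B..<p} \<union> {C..<C'}) \<union>
     ({w..<b} \<union> ({p'..<C} \<union> ({C'..<s} \<union> {s'..<k}))))"
    unfolding b(1)[symmetric] C_def[symmetric] s_def[symmetric] k_def[symmetric] q_def by (simp only: add_0_right add.assoc)
  also have "{1..<w} \<union> ({a..<B} \<union> {p..<p'} \<union> {b..<A} \<union> {s..<s'} \<union> {k..<k'}) \<union>
     ({A..<a} \<union> {B..<p} \<union> {C..<C'}) \<union>
     ({w..<b} \<union> ({p'..<C} \<union> ({C'..<s} \<union> {s'..<k})))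
    = {1..<w} \<union> {w..<b} \<union> {b..<A} \<union> {A..<a} \<union> {a..<B} \<union> {B..<p} \<union> {p..<p'} \<union> {p'..<C} \<union> {C..<C'}
      \<union> {C'..<s} \<union> {s..<s'} \<union> {s'..<k} \<union> {k..<k'}"
    by (simp only: Un_ac)
  also have "\<dots> = {1..<k'}"
  proof -
    have "1 \<le> w" "1 \<le> b" "1 \<le> A" "1 \<le> a" "1 \<le> B" "1 \<le> p" "1 \<le> p'" "1 \<le> C" "1 \<le> C'"
      "1 \<le> s" "1 \<le> s'" "1 \<le> k" "w \<le> b" "b \<le> A" "A \<le> a" "a \<le> B" "B \<le> p" "p \<le> p'" "p' \<le> C" "C \<le> C'" "C' \<le> s"
      "s \<le> s'" "s' \<le> k" "k \<le> k'"
      unfolding defs b(1) w_def by simp_all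
    then show ?thesis by (simp only: ivl_join)
  qed
  also have "{1..<k'} = {1..9 * (c + (2 * m + 1)) + 6 * (g + 4 * h) + 4 * q}"
  proof -
    have "k' = 9 * (c + (2 * m + 1)) + 6 * (g + 4 * h) + 4 * q + 1"
      using b(1) unfolding defs q_def w_def by simp
    then show ?thesis by auto
  qed
  finally have "packs (c + (2 * m + 1)) (g + 4 * h) q {1..9 * (c + (2 * m + 1)) + 6 * (g + 4 * h) + 4 * q}" .
  moreover have "q \<le> g + 4 * h"
  proof -
    have "e + 4 * z3 + 4 * z2 = 4 * h + e + 4 * z4" using z2 z3 b(2) by metis
    then have z23: "z2 + z3 = h + z4" by linarith
    have "q = r + z1 + (z2 + z3) + z4" unfolding q_def by (simp only: add.assoc)
    then have "q = r + z1 + (h + z4) + z4" unfolding z23 .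
    then show ?thesis by (rule ssubst) (rule gap_bound[OF b(1)[unfolded w_def] b(2,3) e(2) h])
  qed
  ultimately show ?thesis by (intro exI[of _ q] conjI)
qed

section \<open>Explicit packings\<close>

text \<open>\<open>Family h a p b e\<close> stands for the \<open>4h\<close> gadgets of lemma \<open>gadget_family\<close>; its last two runs are
  determined by the others, and \<open>wf_piece\<close> rules out truncation in the subtractions.\<close>

datatype piece =
  Corner nat nat nat
| Up nat nat
| Down nat nat
| Quads nat nat
| Family nat nat nat nat nat

definition progression :: "nat \<Rightarrow> nat \<Rightarrow> (nat \<times> nat) list" where
  "progression a d = (if d = 1 then [(a, 3)] else [(a, 1), (a + d, 1), (a + 2 * d, 1)])"

fun runs :: "piece \<Rightarrow> (nat \<times> nat) list" where
  "runs (Corner a b d) = progression a d @ progression b d @ progression (a + b + d) d"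
| "runs (Up a b) = [(a, 2), (b, 2), (a + b, 1), (a + b + 2, 1)]"
| "runs (Down a b) = [(a, 1), (a + 2, 1), (b, 2), (a + b + 1, 2)]"
| "runs (Quads a n) = [(a, 4 * n)]"
| "runs (Family h a p b e) =
     [(a, 4 * h), (p, 4 * h), (b, 4 * h), (a + p - e, 8 * h), (b + 4 * h + a + p - 2 * e, 4 * h)]"

fun sizes :: "piece \<Rightarrow> nat \<times> nat \<times> nat" where
  "sizes (Corner a b d) = (1, 0, 0)"
| "sizes (Up a b) = (0, 1, 0)"
| "sizes (Down a b) = (0, 1, 0)"
| "sizes (Quads a n) = (0, 0, n)"
| "sizes (Family h a p b e) = (0, 4 * h, 0)"

fun wf_piece :: "piece \<Rightarrow> bool" where
  "wf_piece (Family h a p b e) \<longleftrightarrow> e \<le> 1 \<and> 1 \<le> a \<and> 1 \<le> p"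
| "wf_piece _ \<longleftrightarrow> True"

definition cover :: "(nat \<times> nat) list \<Rightarrow> nat set" where
  "cover rs = (\<Union>(a, l)\<in>set rs. {a..<a + l})"

lemma cover_simps [simp]:
  "cover [] = {}" "cover ((a, l) # rs) = {a..<a + l} \<union> cover rs" "cover (rs @ rs') = cover rs \<union> cover rs'"
  by (auto simp: cover_def)

lemma cover_progression: "cover (progression a d) = {a, a + d, a + 2 * d}"
  by (auto simp: progression_def)

lemma packs_piece:
  assumes "wf_piece x" "sizes x = (c, g, q)"
  shows "packs c g q (cover (runs x))"
proof (cases x)
  case (Corner a b d)
  have "cover (runs x) = {} \<union> set (corner_list a b d)"
    unfolding Corner runs.simps cover_simps cover_progression corner_list_def by auto
  then show ?thesis
    using packs.corner[OF packs.empty corner_corner_list[of a b d]] assms(2) Corner by (auto simp del: runs.simps)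
next
  case (Up a b)
  have "cover (runs x) = {} \<union> set (gadget_up a b)"
    by (auto simp: Up gadget_up_def)
  then show ?thesis
    using packs.gadget[OF packs.empty gadget_gadget_up[of a b]] assms(2) Up by (auto simp del: runs.simps)
next
  case (Down a b)
  have "cover (runs x) = {} \<union> set (gadget_dn a b)"
    by (auto simp: Down gadget_dn_def)
  then show ?thesis
    using packs.gadget[OF packs.empty gadget_gadget_dn[of a b]] assms(2) Down by (auto simp del: runs.simps)
next
  case (Quads a n)
  then show ?thesis using packs_quads[of n a] assms(2) by simp
next
  case (Family h a p b e)
  then have "a + p - e + e = a + p" "b + 4 * h + a + p - 2 * e + e = b + 4 * h + (a + p - e)" "e \<le> 1"
    using assms(1) by auto
  from gadget_family[OF this] show ?thesis
    using Family assms(2) by (simp add: Un_assoc)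
qed

fun tiling :: "nat \<Rightarrow> (nat \<times> nat) list \<Rightarrow> nat \<Rightarrow> bool" where
  "tiling x [] y \<longleftrightarrow> x = y"
| "tiling x ((a, l) # rs) y \<longleftrightarrow> a = x \<and> tiling (x + l) rs y"

lemma tiling_cover: "tiling x rs y \<Longrightarrow> x \<le> y \<and> cover rs = {x..<y}"
  by (induction x rs y rule: tiling.induct) (auto simp: ivl_join)

text \<open>After sorting by starting point, covering an initial segment means that each run begins
  where the previous one stops. The simplifier decides this by evaluation.\<close>

lemma packs_pieces:
  assumes "list_all wf_piece ps" "tiling 1 (sort_key fst (concat (map runs ps))) (N + 1)"
    and "sum_list (map (fst \<circ> sizes) ps) = c" "sum_list (map (fst \<circ> snd \<circ> sizes) ps) = g"
    and "sum_list (map (snd \<circ> snd \<circ> sizes) ps) = q"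
  shows "packs c g q {1..N}"
proof -
  have "packs (sum_list (map (fst \<circ> sizes) ps)) (sum_list (map (fst \<circ> snd \<circ> sizes) ps))
    (sum_list (map (snd \<circ> snd \<circ> sizes) ps)) (cover (concat (map runs ps)))"
    using assms(1)
  proof (induction ps)
    case Nil
    then show ?case using packs.empty by simp
  next
    case (Cons x ps)
    obtain c g q where "sizes x = (c, g, q)" by (cases "sizes x")
    then show ?case
      using packs_Un[OF packs_piece[of x] Cons.IH] Cons.prems by simp
  qed
  moreover have "cover (concat (map runs ps)) = cover (sort_key fst (concat (map runs ps)))"
    by (simp add: cover_def)
  moreover have "\<dots> = {1..N}"
    using tiling_cover[OF assms(2)] by auto
  ultimately show ?thesis using assms(3-5) by simp
qed

text \<open>The following packings were found by computer search.\<close>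

lemma packs_1_1: "packs 1 1 3 {1..27}"
  by (rule packs_pieces[of "[Corner 5 6 2, Down 14 11, Quads 1 1, Quads 18 2]"])
    (simp_all add: progression_def)

lemma packs_1_3: "packs 1 3 0 {1..27}"
  by (rule packs_pieces[of "[Corner 2 4 5, Down 1 22, Down 8 17, Down 13 5]"])
    (simp_all add: progression_def)

lemma packs_1_5: "packs 1 5 1 {1..43}"
  by (rule packs_pieces[of "[Corner 10 22 3, Down 1 18, Down 2 36, Up 5 7, Down 9 23, Down 15 26, Quads 29 1]"])
    (simp_all add: progression_def)

lemma packs_1_7: "packs 1 7 2 {1..59}"
  by (rule packs_pieces[of "[Corner 17 32 2, Down 7 5, Down 8 30, Up 11 41, Down 18 37, Down 26 22, Down 27 15,
      Down 33 24, Quads 1 1, Quads 45 1]"])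
    (simp_all add: progression_def)

lemma packs_1_9: "packs 1 9 9 {1..99}"
  by (rule packs_pieces[of "[Corner 25 26 2, Down 54 43, Family 2 9 58 17 1, Quads 1 2, Quads 31 3, Quads 45 2,
      Quads 82 2]"])
    (simp_all add: progression_def)

lemma packs_1_11: "packs 1 11 11 {1..119}"
  by (rule packs_pieces[of "[Corner 23 24 2, Up 5 7, Down 11 58, Down 50 9, Family 2 15 62 29 1, Quads 1 1, Quads 37 3,
      Quads 54 1, Quads 72 1, Quads 92 5]"])
    (simp_all add: progression_def)

lemma packs_1_13: "packs 1 13 12 {1..135}"
  by (rule packs_pieces[of "[Corner 25 26 2, Down 54 43, Family 3 31 70 13 1, Quads 1 3, Quads 45 2, Quads 58 3,
      Quads 82 4]"])
    (simp_all add: progression_def)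

lemma packs_2_1: "packs 2 1 3 {1..36}"
  by (rule packs_pieces[of "[Corner 2 22 1, Corner 1 6 7, Down 5 29, Quads 9 1, Quads 16 1, Quads 31 1]"])
    (simp_all add: progression_def)

lemma packs_2_3: "packs 2 3 1 {1..40}"
  by (rule packs_pieces[of "[Corner 5 29 1, Corner 8 12 6, Down 11 15, Down 17 21, Down 23 9, Quads 1 1]"])
    (simp_all add: progression_def)

lemma packs_3_0: "packs 3 0 1 {1..31}"
  by (rule packs_pieces[of "[Corner 5 20 1, Corner 8 14 1, Corner 11 17 1, Quads 1 1]"])
    (simp_all add: progression_def)

lemma packs_3_2: "packs 3 2 1 {1..43}"
  by (rule packs_pieces[of "[Corner 2 32 1, Corner 10 27 1, Corner 1 6 12, Down 5 8, Down 24 16, Quads 20 1]"])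
    (simp_all add: progression_def)

lemma packs_3_18: "packs 3 18 14 {1..191}"
  by (rule packs_pieces[of "[Corner 13 111 1, Corner 18 166 1, Corner 55 62 1, Up 16 53, Down 70 93,
      Family 4 37 95 21 0, Quads 1 3, Quads 58 1, Quads 65 1, Quads 73 5, Quads 114 1,
      Quads 121 1, Quads 128 1, Quads 188 1]"])
    (simp_all add: progression_def)

lemma packs_4_0: "packs 4 0 2 {1..44}"
  by (rule packs_pieces[of "[Corner 5 29 1, Corner 8 23 1, Corner 11 14 1, Corner 17 20 1, Quads 1 1, Quads 41 1]"])
    (simp_all add: progression_def)

lemma packs_4_2: "packs 4 2 3 {1..60}"
  by (rule packs_pieces[of "[Corner 7 19 1, Corner 10 24 1, Corner 13 42 1, Corner 16 32 1, Up 22 30, Down 53 5,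
      Quads 1 1, Quads 38 1, Quads 45 1]"])
    (simp_all add: progression_def)

lemma packs_4_16: "packs 4 16 15 {1..192}"
  by (rule packs_pieces[of "[Corner 5 75 1, Corner 32 45 1, Corner 35 48 1, Corner 42 147 1, Family 4 16 87 55 0,
      Quads 1 1, Quads 8 2, Quads 38 1, Quads 51 1, Quads 71 1, Quads 135 3, Quads 150 6]"])
    (simp_all add: progression_def)

lemma packs_6_3: "packs 6 3 4 {1..88}"
  by (rule packs_pieces[of "[Corner 16 35 1, Corner 25 30 2, Corner 38 41 1, Corner 5 65 1, Corner 11 62 1,
      Corner 8 68 1, Up 14 44, Down 26 19, Down 31 55, Quads 1 1, Quads 21 1, Quads 48 1,
      Quads 83 1]"])
    (simp_all add: progression_def)

lemma packs_6_5: "packs 6 5 2 {1..92}"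
  by (rule packs_pieces[of "[Corner 1 50 5, Corner 14 57 1, Corner 21 62 1, Corner 30 44 1, Corner 36 41 1,
      Corner 33 47 1, Down 7 4, Down 8 19, Down 51 39, Down 52 17, Down 65 2, Quads 24 1,
      Quads 87 1]"])
    (simp_all add: progression_def)

lemma packs_7_0: "packs 7 0 2 {1..71}"
  by (rule packs_pieces[of "[Corner 5 59 1, Corner 8 32 1, Corner 11 38 1, Corner 14 47 1, Corner 17 35 1,
      Corner 20 23 1, Corner 26 29 1, Quads 1 1, Quads 68 1]"])
    (simp_all add: progression_def)

text \<open>This is the packing of \<open>packs_3_2\<close> with a family of five corners above it,
  the nine quads filling the gap before the corner sums. It serves only as a base, having more quads
  than gadgets.\<close>

lemma packs_8_2: "packs 8 2 10 {1..124}"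
  by (rule packs_pieces[of "[Corner 2 32 1, Corner 10 27 1, Corner 1 6 12, Down 5 8, Down 24 16, Corner 44 65 1,
      Corner 50 62 1, Corner 56 59 1, Corner 47 71 1, Corner 53 68 1, Quads 20 1, Quads 74 9]"])
    (simp_all add: progression_def)

section \<open>Existence\<close>

definition packable :: "nat \<Rightarrow> nat \<Rightarrow> bool" where
  "packable c g \<longleftrightarrow> (\<exists>q \<le> g. packs c g q {1..9 * c + 6 * g + 4 * q})"

lemma packableI:
  assumes "packs c0 g0 q {1..N}" "c = c0" "g = g0" "q \<le> g0" "N = 9 * c0 + 6 * g0 + 4 * q"
  shows "packable c g"
  using assms unfolding packable_def by blast

lemma packable_without_corners:
  assumes "packs c0 g0 r {1..N}" "N = 9 * c0 + 6 * g0 + 4 * r" "c = c0" "g = g0 + 4 * h"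
    and "(N + 1) mod 4 = e" "e \<le> 1" "2 + 18 * c0 + 8 * g0 + 12 * r \<le> 20 * h + 2 * e"
  shows "packable c g"
  using layout_without_corners[of c g0 r e h] assms unfolding packable_def by (simp only:)

text \<open>The congruence \<open>(3 * m + 2) mod 4 = e\<close> forces \<open>m\<close> to be 2 - e
  modulo 4. So the added corners number \<open>8 * j + 5\<close> for \<open>e = 0\<close> and
  \<open>8 * j + 3\<close> for \<open>e = 1\<close>, and the base has to supply the remaining
  residue of \<open>c\<close> modulo 8.\<close>

lemma packable_with_corners:
  assumes "packs c0 g0 r {1..N}" "N = 9 * c0 + 6 * g0 + 4 * r" "c + 2 * e = c0 + 8 * j + 5" "g = g0 + 4 * h"
    and "(N + 1) mod 4 = e" "e \<le> 1" "12 * j + 8 \<le> 4 * h + 3 * e"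
    and "2 + 18 * c0 + 8 * g0 + 12 * r \<le> 20 * h + 2 * e"
  shows "packable c g"
proof -
  define m where "m = 4 * j + 2 - e"
  have e: "e = 0 \<or> e = 1" using assms(6) by linarith
  then have "3 * m + 2 = e + 4 * (3 * j + 2 - e)"
    unfolding m_def by auto
  then have m: "c = c0 + (2 * m + 1)" "(3 * m + 2) mod 4 = e" "3 * m + 2 \<le> 4 * h"
    using e assms(3,7) by (auto simp: m_def)
  show ?thesis
    using layout_with_corners[of c0 g0 r e m h] assms m unfolding packable_def by (simp only:)
qed

lemma packable_0_mod_4:
  assumes "0 < c" "c mod 4 = 0" "g mod 4 = 0" "4 * c \<le> g"
  shows "packable c g"
proof -
  define j where "j = c div 8"
  define h where "h = g div 4"
  have g: "g = 4 * h" unfolding h_def using assms(3) mult_div_mod_eq[of 4 g] by simp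
  have "c mod 8 = 0 \<or> c mod 8 = 4" using assms(2) by presburger
  then have "c = 8 * j \<or> c = 8 * j + 4" unfolding j_def using mult_div_mod_eq[of 8 c] by presburger
  \<comment> \<open>For \<open>c = 4\<close> the base already contains every corner, and its size
    condition requires \<open>5 \<le> h\<close>; this leaves 16 gadgets as an explicit case.\<close>
  then consider i where "c = 8 * i + 8" | "c = 4" "h = 4" | "c = 4" "5 \<le> h" | i where "c = 8 * i + 12"
    using assms(1,4) g by (cases j) (fastforce simp: le_less)+
  then show ?thesis
  proof cases
    case (1 i)
    then show ?thesis using assms(4) g by (intro packable_with_corners[OF packs_3_0, of _ 0 i _ h]) simp_all
  next
    case 2
    then show ?thesis using g by (intro packableI[OF packs_4_16]) simp_all
  next
    case 3
    then show ?thesis using g by (intro packable_without_corners[OF packs_4_0, of _ _ h 1]) simp_all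
  next
    case (4 i)
    then show ?thesis using assms(4) g by (intro packable_with_corners[OF packs_7_0, of _ 0 i _ h]) simp_all
  qed
qed

lemma packable_1_mod_4:
  assumes "c mod 4 = 1" "odd g" "5 * c \<le> g"
  shows "packable c g"
proof -
  define j where "j = c div 8"
  define h where "h = g div 4"
  have "g mod 4 = 1 \<or> g mod 4 = 3" using assms(2) by presburger
  then have g: "g = 4 * h + 1 \<or> g = 4 * h + 3" unfolding h_def using mult_div_mod_eq[of 4 g] by presburger
  have "c mod 8 = 1 \<or> c mod 8 = 5" using assms(1) by presburger
  then have "c = 8 * j + 1 \<or> c = 8 * j + 5" unfolding j_def using mult_div_mod_eq[of 8 c] by presburger
  then consider "c = 1" | i where "c = 8 * i + 9" | "c = 8 * j + 5"
    by (cases j) auto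
  then show ?thesis
  proof cases
    case 1
    have "1 \<le> h" using g assms(3) 1 by auto
    \<comment> \<open>The size conditions for the bases \<open>packs_1_3\<close> and
      \<open>packs_1_1\<close> hold from \<open>h = 3\<close> and \<open>h = 4\<close> on, so odd
      \<open>g\<close> up to 13 is listed explicitly.\<close>
    then consider "g = 5" | "g = 7" | "g = 9" | "g = 11" | "g = 13" | "g = 4 * h + 3" "3 \<le> h" | "g = 4 * h + 1" "4 \<le> h"
      using g by (cases "h = 1"; cases "h = 2"; cases "h = 3") auto
    then show ?thesis
    proof cases
      case 6
      then show ?thesis using 1 by (intro packable_without_corners[OF packs_1_3, of _ _ h 0]) simp_all
    next
      case 7
      then show ?thesis using 1 by (intro packable_without_corners[OF packs_1_1, of _ _ h 0]) simp_all
    qed (use 1 in \<open>auto intro: packableI[OF packs_1_5] packableI[OF packs_1_7] packableI[OF packs_1_9]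
        packableI[OF packs_1_11] packableI[OF packs_1_13]\<close>)
  next
    case (2 i)
    from g show ?thesis
    proof
      assume "g = 4 * h + 1"
      then show ?thesis using assms(3) 2
        by (intro packable_with_corners[OF packs_6_5, of _ 1 i _ "h - 1"]) simp_all
    next
      assume "g = 4 * h + 3"
      then show ?thesis using assms(3) 2
        by (intro packable_with_corners[OF packs_6_3, of _ 1 i _ h]) simp_all
    qed
  next
    case 3
    from g show ?thesis
    proof
      assume "g = 4 * h + 1"
      then show ?thesis using assms(3) 3
        by (intro packable_with_corners[OF packs_2_1, of _ 1 j _ h]) simp_all
    next
      assume "g = 4 * h + 3"
      then show ?thesis using assms(3) 3
        by (intro packable_with_corners[OF packs_2_3, of _ 1 j _ h]) simp_all
    qed
  qed
qed

lemma packable_3_mod_4: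
  assumes "c mod 4 = 3" "g mod 4 = 0 \<and> 4 * c \<le> g \<or> g mod 4 = 2 \<and> 6 * c \<le> g"
  shows "packable c g"
proof -
  define j where "j = c div 8"
  define h where "h = g div 4"
  have g: "g = 4 * h \<and> 4 * c \<le> g \<or> g = 4 * h + 2 \<and> 6 * c \<le> g"
    unfolding h_def using assms(2) mult_div_mod_eq[of 4 g] by presburger
  have "c mod 8 = 3 \<or> c mod 8 = 7" using assms(1) by presburger
  then have "c = 8 * j + 3 \<or> c = 8 * j + 7" unfolding j_def using mult_div_mod_eq[of 8 c] by presburger
  then show ?thesis
  proof
    assume c: "c = 8 * j + 3"
    from g show ?thesis
    proof
      assume "g = 4 * h \<and> 4 * c \<le> g"
      then show ?thesis using c packs.empty
        by (intro packable_with_corners[of 0 0 0 0 _ 1 j _ h]) simp_all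
    next
      assume *: "g = 4 * h + 2 \<and> 6 * c \<le> g"
      \<comment> \<open>For \<open>c = 3\<close> and \<open>h = 4\<close> the size condition with
        base \<open>packs_3_2\<close> just fails, 84 against 80.\<close>
      then consider i where "c = 8 * i + 11" | "c = 3" "g = 18" | "c = 3" "5 \<le> h"
        using c by (cases j; cases "h = 4") auto
      then show ?thesis
      proof cases
        case (1 i)
        then show ?thesis using * by (intro packable_with_corners[OF packs_8_2, of _ 1 i _ h]) simp_all
      next
        case 3
        then show ?thesis using * by (intro packable_without_corners[OF packs_3_2, of _ _ h 0]) simp_all
      qed (auto intro: packableI[OF packs_3_18])
    qed
  next
    assume c: "c = 8 * j + 7"
    from g show ?thesis
    proof
      assume "g = 4 * h \<and> 4 * c \<le> g"
      then show ?thesis using c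
        by (intro packable_with_corners[OF packs_4_0, of _ 1 j _ h]) simp_all
    next
      assume "g = 4 * h + 2 \<and> 6 * c \<le> g"
      then show ?thesis using c
        by (intro packable_with_corners[OF packs_4_2, of _ 1 j _ h]) simp_all
    qed
  qed
qed

theorem theorem1p4:
  fixes m n c :: nat
  assumes "m > 0" "n > 0" "c > 0"
    and "(m * n * c) mod 4 = 0 \<or> (m * n * c) mod 4 = 3"
    and "m \<ge> 7" "n \<ge> 7" "odd m" "odd n"
  shows "IHS_exists m n c"
proof -
  define p q where "p = (m - 3) div 2" and "q = (n - 3) div 2"
  have m: "m = 3 + 2 * p" and n: "n = 3 + 2 * q"
    unfolding p_def q_def using assms(5-8) by presburger+
  have pq: "2 \<le> p" "2 \<le> q" using assms(5,6) m n by auto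
  define g where "g = p + q"
  have g4: "4 \<le> g" unfolding g_def using pq by simp
  \<comment> \<open>Modulo 4 the product \<open>m * n\<close> depends only on the parity of
    \<open>g\<close>, which turns the divisibility hypothesis into three cases for \<open>c\<close>
    and \<open>g\<close>.\<close>
  have mn: "m * n = 4 * (2 + g + p * q) + 1 + 2 * g"
    unfolding m n g_def by (simp add: algebra_simps)
  have "(4 * x + 1 + 2 * g) mod 4 = (if even g then 1 else 3)" for x
    by presburger
  then have mn4: "(m * n) mod 4 = (if even g then 1 else 3)"
    unfolding mn .
  have mnc: "((m * n) mod 4 * (c mod 4)) mod 4 = 0 \<or> ((m * n) mod 4 * (c mod 4)) mod 4 = 3"
    using assms(4) by (simp only: mod_mult_eq)
  have cg: "(c * g) mod 4 = ((c mod 4) * (g mod 4)) mod 4"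
    by (simp only: mod_mult_eq)
  have "c mod 4 = 0 \<or> c mod 4 = 1 \<or> c mod 4 = 2 \<or> c mod 4 = 3" by presburger
  then consider "c mod 4 = 0" | "c mod 4 = 1" "odd g" | "c mod 4 = 3" "even g"
    using mnc unfolding mn4 by (auto split: if_splits)
  then have "packable c (c * g)"
  proof cases
    case 1
    then show ?thesis using assms(3) g4 cg by (intro packable_0_mod_4) simp_all
  next
    case 2
    then have "odd c" "5 \<le> g" using g4 by presburger+
    then show ?thesis using 2 by (intro packable_1_mod_4) simp_all
  next
    case 3
    \<comment> \<open>Combining \<open>4 \<le> g\<close> with the residue gives the bounds
      \<open>4 * c\<close>, \<open>5 * c\<close> and \<open>6 * c\<close> assumed in the packing
      lemmas.\<close>
    then have "g mod 4 = 0 \<or> g mod 4 = 2 \<and> 6 \<le> g" using g4 by presburger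
    then show ?thesis using 3 g4 cg by (intro packable_3_mod_4) auto
  qed
  then obtain r where "r \<le> c * (p + q)" "packs c (c * (p + q)) r {1..9 * c + 6 * (c * (p + q)) + 4 * r}"
    unfolding packable_def g_def by blast
  then show ?thesis
    unfolding m n using pq by (intro IHS_exists_packs)
qed

end
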